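(* Let $V$ and $W$ be two binomial varieties in $\mathbb{P}^n$ that have the same binomial exponents. Suppose that both $V$ and $W$ contain at least one point with no zero coordinates. Let $<$ be any monomial order on $R=k[x_0,x_1,\ldots,x_n]$. Then the initial ideals $LT_<(I)$ and $LT_<(J)$ of $I =\mathbb{I}(V)$ and $J = \mathbb{I}(W)$, respectively, are equal. That is, $$LT_<(I) = \langle LT_<(f) \mid f \in I \rangle = \langle LT_<(g) \mid g \in J \rangle = LT_<(J).$$
   Context: $k$ is an algebraically closed field of characteristic zero, $\mathbb{P}^n$ is projective $n$-space over $k$, and $R = k[x_0,\ldots,x_n]$ has the standard grading. Projective varieties are Zariski closed subsets of $\mathbb{P}^n$ and need not be irreducible; $\mathbb{I}(X) \subseteq R$ denotes the homogeneous vanishing ideal of $X$. For $\alpha = (\alpha_0,\ldots,\alpha_n) \in \mathbb{N}^{n+1}$, $X^\alpha := x_0^{\alpha_0}\cdots x_n^{\alpha_n}$. $LT_<(f)$ denotes the leading term of $f$ with respect to $<$. A binomial is a polynomial with exactly two terms, $a_1X^{\alpha_1}-a_2X^{\alpha_2}$ with $a_1,a_2 \in k\setminus\{0\}$ and $\alpha_1\neq\alpha_2$; it is homogeneous if both monomials have the same degree. A projective variety $V \subseteq \mathbb{P}^n$ is a binomial variety if $\mathbb{I}(V)$ is generated by homogeneous binomials. Two binomial varieties $V$ and $W$ have the same binomial exponents if there are ordered lists $\alpha_1,\ldots,\alpha_s$ and $\beta_1,\ldots,\beta_s$ in $\mathbb{N}^{n+1}$, with $\alpha_i \neq \beta_i$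 for all $i$ and the pairs $(\alpha_i,\beta_i)$ pairwise distinct, and nonzero constants $a_i,b_i,c_i,d_i \in k$ ($i=1,\ldots,s$) such that $\mathbb{I}(V) = \langle a_1X^{\alpha_1}-b_1X^{\beta_1},\ldots,a_sX^{\alpha_s}-b_sX^{\beta_s}\rangle$ and $\mathbb{I}(W) = \langle c_1X^{\alpha_1}-d_1X^{\beta_1},\ldots,c_sX^{\alpha_s}-d_sX^{\beta_s}\rangle$. *)

theory Defs
  imports "HOL-Library.Poly_Mapping" "HOL-Computational_Algebra.Polynomial"
begin

section \<open>The polynomial ring\<close>

text \<open>
  The variables \<open>x\<^sub>0, \<dots>, x\<^sub>n\<close> are indexed by a finite type \<open>'v\<close> with \<open>n + 1\<close> elements; as \<open>'v\<close>
  is an arbitrary finite type, \<open>n\<close> is an arbitrary natural number. An element of \<open>\<nat>\<^sup>n\<^sup>+\<^sup>1\<close> is a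
  \<open>'v \<Rightarrow>\<^sub>0 nat\<close>, and multiplication in \<open>('v, 'k) mpoly\<close> is the convolution product of
  \<^theory>\<open>HOL-Library.Poly_Mapping\<close>, so that \<open>X\<^sup>\<alpha> * X\<^sup>\<beta> = X\<^sup>\<alpha>\<^sup>+\<^sup>\<beta>\<close>.
\<close>

type_synonym 'v exponent = "'v \<Rightarrow>\<^sub>0 nat"
type_synonym ('v, 'k) mpoly = "'v exponent \<Rightarrow>\<^sub>0 'k"

text \<open>\<open>mterm a \<alpha>\<close> is \<open>a X\<^sup>\<alpha>\<close>.\<close>

abbreviation mterm :: "'k::zero \<Rightarrow> 'v exponent \<Rightarrow> ('v, 'k) mpoly" where
  "mterm a \<alpha> \<equiv> Poly_Mapping.single \<alpha> a"

definition total_degree :: "'v::finite exponent \<Rightarrow> nat" where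
  "total_degree \<alpha> = (\<Sum>i\<in>UNIV. Poly_Mapping.lookup \<alpha> i)"

definition homogeneous :: "('v::finite, 'k::zero) mpoly \<Rightarrow> bool" where
  "homogeneous f \<longleftrightarrow> (\<exists>d. \<forall>\<alpha>\<in>Poly_Mapping.keys f. total_degree \<alpha> = d)"

definition eval_mpoly :: "('v::finite, 'k::comm_semiring_1) mpoly \<Rightarrow> ('v \<Rightarrow> 'k) \<Rightarrow> 'k" where
  "eval_mpoly f p = (\<Sum>\<alpha>\<in>Poly_Mapping.keys f.
     Poly_Mapping.lookup f \<alpha> * (\<Prod>i\<in>UNIV. p i ^ Poly_Mapping.lookup \<alpha> i))"

text \<open>The ideal generated by a set, as its span in the ring regarded as a module over itself.\<close>

lemma module_times: "module ((*) :: 'a::comm_ring_1 \<Rightarrow> 'a \<Rightarrow> 'a)"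
  by unfold_locales (simp_all add: algebra_simps)

definition ideal_generated :: "'a::comm_ring_1 set \<Rightarrow> 'a set" where
  "ideal_generated S = module.span (*) S"


section \<open>Projective varieties\<close>

text \<open>A point of projective space is the set of all its homogeneous coordinate vectors.\<close>

definition proportional :: "(('v \<Rightarrow> 'k::field) \<times> ('v \<Rightarrow> 'k)) set" where
  "proportional = {(p, q). \<exists>c. c \<noteq> 0 \<and> q = (\<lambda>i. c * p i)}"

definition proj_space :: "('v \<Rightarrow> 'k::field) set set" where
  "proj_space = {p. p \<noteq> (\<lambda>i. 0)} // proportional"

definition vanishes_at :: "('v::finite, 'k::field) mpoly \<Rightarrow> ('v \<Rightarrow> 'k) set \<Rightarrow> bool" where
  "vanishes_at f P \<longleftrightarrow> (\<forall>p\<in>P. eval_mpoly f p = 0)"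

definition proj_variety :: "('v::finite \<Rightarrow> 'k::field) set set \<Rightarrow> bool" where
  "proj_variety V \<longleftrightarrow>
     (\<exists>S. (\<forall>f\<in>S. homogeneous f) \<and> V = {P \<in> proj_space. \<forall>f\<in>S. vanishes_at f P})"

definition vanishing_ideal :: "('v::finite \<Rightarrow> 'k::field) set set \<Rightarrow> ('v, 'k) mpoly set" where
  "vanishing_ideal V = ideal_generated {f. homogeneous f \<and> (\<forall>P\<in>V. vanishes_at f P)}"

definition no_zero_coordinates :: "('v \<Rightarrow> 'k::zero) set \<Rightarrow> bool" where
  "no_zero_coordinates P \<longleftrightarrow> (\<forall>p\<in>P. \<forall>i. p i \<noteq> 0)"


section \<open>Binomial varieties\<close>

definition binomial_mpoly :: "('v, 'k::field) mpoly \<Rightarrow> bool" where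
  "binomial_mpoly f \<longleftrightarrow> (\<exists>a b \<alpha> \<beta>. a \<noteq> 0 \<and> b \<noteq> 0 \<and> \<alpha> \<noteq> \<beta> \<and> f = mterm a \<alpha> - mterm b \<beta>)"

definition binomial_variety :: "('v::finite \<Rightarrow> 'k::field) set set \<Rightarrow> bool" where
  "binomial_variety V \<longleftrightarrow> proj_variety V \<and>
     (\<exists>B. (\<forall>f\<in>B. binomial_mpoly f \<and> homogeneous f) \<and> vanishing_ideal V = ideal_generated B)"

definition same_binomial_exponents ::
  "('v::finite \<Rightarrow> 'k::field) set set \<Rightarrow> ('v \<Rightarrow> 'k) set set \<Rightarrow> bool" where
  "same_binomial_exponents V W \<longleftrightarrow>
     (\<exists>(s::nat) (\<alpha> :: nat \<Rightarrow> 'v exponent) (\<beta> :: nat \<Rightarrow> 'v exponent)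
        (a :: nat \<Rightarrow> 'k) (b :: nat \<Rightarrow> 'k) (c :: nat \<Rightarrow> 'k) (d :: nat \<Rightarrow> 'k).
        (\<forall>i<s. \<alpha> i \<noteq> \<beta> i) \<and>
        inj_on (\<lambda>i. (\<alpha> i, \<beta> i)) {..<s} \<and>
        (\<forall>i<s. a i \<noteq> 0 \<and> b i \<noteq> 0 \<and> c i \<noteq> 0 \<and> d i \<noteq> 0) \<and>
        vanishing_ideal V = ideal_generated {mterm (a i) (\<alpha> i) - mterm (b i) (\<beta> i) | i. i < s} \<and>
        vanishing_ideal W = ideal_generated {mterm (c i) (\<alpha> i) - mterm (d i) (\<beta> i) | i. i < s})"


section \<open>Monomial orders and initial ideals\<close>

definition monomial_order :: "('v exponent \<Rightarrow> 'v exponent \<Rightarrow> bool) \<Rightarrow> bool" where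
  "monomial_order lt \<longleftrightarrow> irreflp lt \<and> transp lt \<and> totalp lt \<and> wfp lt \<and>
     (\<forall>\<alpha> \<beta> \<gamma>. lt \<alpha> \<beta> \<longrightarrow> lt (\<alpha> + \<gamma>) (\<beta> + \<gamma>))"

text \<open>The leading term includes the coefficient; the leading term of \<open>0\<close> is \<open>0\<close> by convention.\<close>

definition leading_exponent ::
  "('v exponent \<Rightarrow> 'v exponent \<Rightarrow> bool) \<Rightarrow> ('v, 'k::zero) mpoly \<Rightarrow> 'v exponent" where
  "leading_exponent lt f = (THE \<alpha>. \<alpha> \<in> Poly_Mapping.keys f \<and>
     (\<forall>\<beta>\<in>Poly_Mapping.keys f. \<beta> \<noteq> \<alpha> \<longrightarrow> lt \<beta> \<alpha>))"

definition leading_term ::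
  "('v exponent \<Rightarrow> 'v exponent \<Rightarrow> bool) \<Rightarrow> ('v, 'k::zero) mpoly \<Rightarrow> ('v, 'k) mpoly" where
  "leading_term lt f = (if f = 0 then 0
     else mterm (Poly_Mapping.lookup f (leading_exponent lt f)) (leading_exponent lt f))"

definition initial_ideal ::
  "('v exponent \<Rightarrow> 'v exponent \<Rightarrow> bool) \<Rightarrow> ('v, 'k::comm_ring_1) mpoly set \<Rightarrow> ('v, 'k) mpoly set" where
  "initial_ideal lt I = ideal_generated {leading_term lt f | f. f \<in> I}"

end

theory Submission
  imports Defs
begin

text \<open>
  Let \<open>p\<close> and \<open>q\<close> be coordinate vectors of points of \<open>V\<close> and \<open>W\<close> without zero coordinates. Since
  \<open>a p\<^sup>\<alpha> = b p\<^sup>\<beta>\<close> and \<open>c q\<^sup>\<alpha> = d q\<^sup>\<beta>\<close>, the automorphism \<open>x\<^sub>i \<mapsto> (p\<^sub>i / q\<^sub>i) x\<^sub>i\<close> takes every generator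
  \<open>a X\<^sup>\<alpha> - b X\<^sup>\<beta>\<close> of \<open>\<I>(V)\<close> to a scalar multiple of the generator \<open>c X\<^sup>\<alpha> - d X\<^sup>\<beta>\<close> of \<open>\<I>(W)\<close>. It
  multiplies each monomial by a nonzero scalar, so it changes leading terms by units only.
\<close>

interpretation ring_module: module "(*) :: 'a::comm_ring_1 \<Rightarrow> 'a \<Rightarrow> 'a"
  by (rule module_times)

text \<open>Every element of the span is built by steps \<open>c * x + y\<close> with
  \<open>x\<close> a generator, and \<open>h\<close> turns this into \<open>h c * h x + h y\<close>.
  Used for evaluation at a point and for rescaling.\<close>

lemma ideal_generated_image:
  fixes h :: "'a::comm_ring_1 \<Rightarrow> 'b::comm_ring_1"
  assumes add: "\<And>x y. h (x + y) = h x + h y"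
    and mult: "\<And>x y. h (x * y) = h x * h y"
    and gens: "\<And>x. x \<in> S \<Longrightarrow> h x \<in> ideal_generated T"
    and f: "f \<in> ideal_generated S"
  shows "h f \<in> ideal_generated T"
proof -
  have zero: "h 0 = 0" using add[of 0 0] by simp
  show ?thesis
    using f unfolding ideal_generated_def
  proof (induction rule: ring_module.span_induct_alt)
    case base
    show ?case by (simp add: zero ring_module.span_zero)
  next
    case (step c x y)
    then show ?case
      using gens[of x]
      by (simp add: add mult ideal_generated_def ring_module.span_add ring_module.span_scale)
  qed
qed

text \<open>The value of a monomial at a point, and also the factor that a diagonal substitution
  puts in front of that monomial.\<close>

definition monomial_value :: "('v::finite \<Rightarrow> 'k::comm_semiring_1) \<Rightarrow> 'v exponent \<Rightarrow> 'k" where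
  "monomial_value p \<alpha> = (\<Prod>i\<in>UNIV. p i ^ Poly_Mapping.lookup \<alpha> i)"

lemma monomial_value_add: "monomial_value p (\<alpha> + \<beta>) = monomial_value p \<alpha> * monomial_value p \<beta>"
  by (simp add: monomial_value_def lookup_add power_add prod.distrib)

lemma monomial_value_nonzero:
  fixes p :: "'v::finite \<Rightarrow> 'k::field"
  shows "(\<And>i. p i \<noteq> 0) \<Longrightarrow> monomial_value p \<alpha> \<noteq> 0"
  by (simp add: monomial_value_def)

lemma monomial_value_divide:
  fixes p q :: "'v::finite \<Rightarrow> 'k::field"
  shows "monomial_value (\<lambda>i. p i / q i) \<alpha> = monomial_value p \<alpha> / monomial_value q \<alpha>"
  by (simp add: monomial_value_def power_divide prod_dividef)

lemma poly_mapping_sum_monomials: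
  "(\<Sum>k\<in>Poly_Mapping.keys f. Poly_Mapping.single k (Poly_Mapping.lookup f k)) = f"
  by (rule poly_mapping_eqI)
    (simp add: lookup_sum lookup_single when_def in_keys_iff sum.delta')

text \<open>Both sides are additive in \<open>f\<close> and in \<open>g\<close>, so it is enough to
  compare them on single terms.\<close>

lemma mult_hom_from_monomials:
  fixes h :: "('a::monoid_add \<Rightarrow>\<^sub>0 'k::comm_semiring_1) \<Rightarrow> 'b::semiring_0"
  assumes add: "\<And>f g. h (f + g) = h f + h g"
    and single: "\<And>\<alpha> \<beta> a b. h (Poly_Mapping.single (\<alpha> + \<beta>) (a * b)) =
      h (Poly_Mapping.single \<alpha> a) * h (Poly_Mapping.single \<beta> b)"
    and zero: "h 0 = 0"
  shows "h (f * g) = h f * h g"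
proof -
  have sum: "h (sum F A) = (\<Sum>x\<in>A. h (F x))" if "finite A" for F :: "'a \<Rightarrow> _" and A
    using that by (induction A rule: finite_induct) (simp_all add: add zero)
  let ?m = "\<lambda>f k. Poly_Mapping.single k (Poly_Mapping.lookup f k)"
  have "h ((\<Sum>k\<in>Poly_Mapping.keys f. ?m f k) * (\<Sum>l\<in>Poly_Mapping.keys g. ?m g l)) =
      h (\<Sum>k\<in>Poly_Mapping.keys f. ?m f k) * h (\<Sum>l\<in>Poly_Mapping.keys g. ?m g l)"
    by (simp add: sum_product sum mult_single single)
  then show ?thesis by (simp only: poly_mapping_sum_monomials)
qed

text \<open>Cancellation can make the support of a sum smaller than the union of the supports; a
  common index set avoids tracking this.\<close>

lemma eval_mpoly_superset:
  assumes "finite S" "Poly_Mapping.keys f \<subseteq> S"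
  shows "eval_mpoly f p = (\<Sum>\<alpha>\<in>S. Poly_Mapping.lookup f \<alpha> * monomial_value p \<alpha>)"
  unfolding eval_mpoly_def monomial_value_def
  by (rule sum.mono_neutral_left) (use assms in \<open>auto simp: in_keys_iff\<close>)

lemma eval_mpoly_add: "eval_mpoly (f + g) p = eval_mpoly f p + eval_mpoly g p"
proof -
  let ?S = "Poly_Mapping.keys f \<union> Poly_Mapping.keys g"
  have "Poly_Mapping.keys (f + g) \<subseteq> ?S" by (rule keys_add)
  then show ?thesis
    by (simp add: eval_mpoly_superset[of ?S] lookup_add distrib_right sum.distrib)
qed

lemma eval_mpoly_single: "eval_mpoly (mterm a \<alpha>) p = a * monomial_value p \<alpha>"
  by (subst eval_mpoly_superset[of "{\<alpha>}"]) auto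

lemma eval_mpoly_mult: "eval_mpoly (f * g) p = eval_mpoly f p * eval_mpoly g p"
  by (rule mult_hom_from_monomials[of "\<lambda>f. eval_mpoly f p"])
    (simp_all add: eval_mpoly_add eval_mpoly_single monomial_value_add mult_ac eval_mpoly_def[of 0])

lemma eval_mpoly_diff:
  fixes p :: "'v::finite \<Rightarrow> 'k::comm_ring_1"
  shows "eval_mpoly (f - g) p = eval_mpoly f p - eval_mpoly g p"
  using eval_mpoly_add[of "f - g" g p] by simp

text \<open>The vanishing ideal is defined by homogeneous generators; evaluation at \<open>p\<close>
  is additive and multiplicative and kills them, hence kills all their combinations.\<close>

lemma eval_vanishing_ideal:
  assumes "f \<in> vanishing_ideal V" "P \<in> V" "p \<in> P"
  shows "eval_mpoly f p = 0"
proof -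
  \<comment> \<open>The ideal generated by the empty set is zero, so membership in it expresses
    vanishing.\<close>
  have "eval_mpoly f p \<in> ideal_generated {}"
    using assms(1) unfolding vanishing_ideal_def
  proof (rule ideal_generated_image[of "\<lambda>f. eval_mpoly f p", rotated -1])
    fix x
    assume "x \<in> {f. homogeneous f \<and> (\<forall>P\<in>V. vanishes_at f P)}"
    then show "eval_mpoly x p \<in> ideal_generated {}"
      using assms(2,3) by (simp add: vanishes_at_def ideal_generated_def)
  qed (simp_all add: eval_mpoly_add eval_mpoly_mult)
  then show ?thesis by (simp add: ideal_generated_def)
qed

text \<open>The substitution \<open>x\<^sub>i \<mapsto> t\<^sub>i x\<^sub>i\<close>.\<close>

definition rescale ::
  "('v::finite \<Rightarrow> 'k::comm_semiring_1) \<Rightarrow> ('v, 'k) mpoly \<Rightarrow> ('v, 'k) mpoly" where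
  "rescale t f = Poly_Mapping.mapp (\<lambda>\<alpha> a. monomial_value t \<alpha> * a) f"

lemma lookup_rescale:
  "Poly_Mapping.lookup (rescale t f) \<alpha> = monomial_value t \<alpha> * Poly_Mapping.lookup f \<alpha>"
  by (auto simp: rescale_def lookup_mapp when_def in_keys_iff)

lemma rescale_add: "rescale t (f + g) = rescale t f + rescale t g"
  by (rule poly_mapping_eqI) (simp add: lookup_rescale lookup_add distrib_left)

lemma rescale_diff:
  fixes t :: "'v::finite \<Rightarrow> 'k::comm_ring_1"
  shows "rescale t (f - g) = rescale t f - rescale t g"
  by (rule poly_mapping_eqI) (simp add: lookup_rescale lookup_minus right_diff_distrib)

lemma rescale_single: "rescale t (mterm a \<alpha>) = mterm (monomial_value t \<alpha> * a) \<alpha>"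
  by (rule poly_mapping_eqI) (simp add: lookup_rescale lookup_single when_def)

lemma rescale_zero: "rescale t 0 = 0"
  by (rule poly_mapping_eqI) (simp add: lookup_rescale)

lemma rescale_mult: "rescale t (f * g) = rescale t f * rescale t g"
  by (rule mult_hom_from_monomials[of "rescale t"])
    (simp_all add: rescale_add rescale_single rescale_zero monomial_value_add mult_single mult_ac)

lemma keys_rescale:
  fixes t :: "'v::finite \<Rightarrow> 'k::field"
  assumes "\<And>i. t i \<noteq> 0"
  shows "Poly_Mapping.keys (rescale t f) = Poly_Mapping.keys f"
  using monomial_value_nonzero[of t] assms by (auto simp: in_keys_iff lookup_rescale)

text \<open>Nonzero \<open>t i\<close> preserve the support, and \<open>leading_exponent\<close>
  depends on the support alone. Only the leading coefficient changes, by a unit that the constant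
  factor undoes.\<close>

lemma leading_term_rescale:
  fixes t :: "'v::finite \<Rightarrow> 'k::field"
  assumes "\<And>i. t i \<noteq> 0"
  shows "leading_term lt f =
    mterm (inverse (monomial_value t (leading_exponent lt f))) 0 * leading_term lt (rescale t f)"
proof -
  have "rescale t f = 0 \<longleftrightarrow> f = 0"
    using keys_rescale[of t f] assms by (metis keys_eq_empty)
  then show ?thesis
    using assms
    by (simp add: leading_term_def leading_exponent_def keys_rescale lookup_rescale mult_single
        monomial_value_nonzero)
qed

lemma initial_ideal_mono_rescale:
  fixes t :: "'v::finite \<Rightarrow> 'k::field"
  assumes t: "\<And>i. t i \<noteq> 0" and I: "\<And>f. f \<in> I \<Longrightarrow> rescale t f \<in> J"
  shows "initial_ideal lt I \<subseteq> initial_ideal lt J"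
proof -
  have "leading_term lt f \<in> initial_ideal lt J" if "f \<in> I" for f
  proof -
    have "leading_term lt (rescale t f) \<in> initial_ideal lt J"
      unfolding initial_ideal_def ideal_generated_def
      using I[OF that] by (blast intro: ring_module.span_base)
    then have "mterm (inverse (monomial_value t (leading_exponent lt f))) 0 *
        leading_term lt (rescale t f) \<in> initial_ideal lt J"
      unfolding initial_ideal_def ideal_generated_def by (rule ring_module.span_scale)
    then show ?thesis by (simp only: leading_term_rescale[of t lt f, OF t, symmetric])
  qed
  then show ?thesis
    unfolding initial_ideal_def ideal_generated_def
    by (intro ring_module.span_minimal) auto
qed

text \<open>The two terms acquire the factors p^\<alpha>/q^\<alpha> and p^\<beta>/q^\<beta>. The
  relations a p^\<alpha> = b p^\<beta> and c q^\<alpha> = d q^\<beta> give a p^\<alpha>/(c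
  q^\<alpha>) = b p^\<beta>/(d q^\<beta>), so one scalar serves for both terms.\<close>

lemma rescale_binomial:
  fixes p q :: "'v::finite \<Rightarrow> 'k::field"
  assumes p: "eval_mpoly (mterm a \<alpha> - mterm b \<beta>) p = 0"
    and q: "eval_mpoly (mterm c \<alpha> - mterm d \<beta>) q = 0"
    and nz: "c \<noteq> 0" "\<And>i. q i \<noteq> 0"
  shows "rescale (\<lambda>i. p i / q i) (mterm a \<alpha> - mterm b \<beta>) =
    mterm (a * monomial_value p \<alpha> / (c * monomial_value q \<alpha>)) 0 * (mterm c \<alpha> - mterm d \<beta>)"
proof -
  have qnz: "monomial_value q \<gamma> \<noteq> 0" for \<gamma>
    using nz(2) by (rule monomial_value_nonzero)
  have ab: "a * monomial_value p \<alpha> = b * monomial_value p \<beta>"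
    and cd: "c * monomial_value q \<alpha> = d * monomial_value q \<beta>"
    using p q by (simp_all add: eval_mpoly_diff eval_mpoly_single)
  \<comment> \<open>Needed to cancel \<open>d\<close> once the scalar is rewritten in terms of
    \<beta>.\<close>
  then have "d \<noteq> 0" using nz(1) qnz by (metis mult_eq_0_iff)
  then have "monomial_value p \<beta> / monomial_value q \<beta> * b =
      a * monomial_value p \<alpha> / (c * monomial_value q \<alpha>) * d"
    unfolding ab cd by simp
  moreover have "monomial_value p \<alpha> / monomial_value q \<alpha> * a =
      a * monomial_value p \<alpha> / (c * monomial_value q \<alpha>) * c"
    using nz(1) by simp
  ultimately show ?thesis
    by (simp only: rescale_diff rescale_single monomial_value_divide right_diff_distrib
        mult_single add_0)
qed

lemma initial_ideal_subset:
  fixes V W :: "('v::finite \<Rightarrow> 'k::field) set set" and s :: nat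
  assumes nz: "\<And>i. i < s \<Longrightarrow> c i \<noteq> 0"
    and V: "vanishing_ideal V = ideal_generated {mterm (a i) (\<alpha> i) - mterm (b i) (\<beta> i) | i. i < s}"
    and W: "vanishing_ideal W = ideal_generated {mterm (c i) (\<alpha> i) - mterm (d i) (\<beta> i) | i. i < s}"
    and P: "P \<in> V" "no_zero_coordinates P" "p \<in> P"
    and Q: "Q \<in> W" "no_zero_coordinates Q" "q \<in> Q"
  shows "initial_ideal lt (vanishing_ideal V) \<subseteq> initial_ideal lt (vanishing_ideal W)"
proof -
  have p: "p i \<noteq> 0" and q: "q i \<noteq> 0" for i
    using P Q by (auto simp: no_zero_coordinates_def)
  have gens: "rescale (\<lambda>i. p i / q i) (mterm (a i) (\<alpha> i) - mterm (b i) (\<beta> i)) \<in> vanishing_ideal W"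
    if i: "i < s" for i
  proof -
    have "mterm (a i) (\<alpha> i) - mterm (b i) (\<beta> i) \<in> vanishing_ideal V"
      unfolding V ideal_generated_def using i by (intro ring_module.span_base) auto
    then have 1: "eval_mpoly (mterm (a i) (\<alpha> i) - mterm (b i) (\<beta> i)) p = 0"
      using P by (blast intro: eval_vanishing_ideal)
    have mem: "mterm (c i) (\<alpha> i) - mterm (d i) (\<beta> i) \<in> vanishing_ideal W"
      unfolding W ideal_generated_def using i by (intro ring_module.span_base) auto
    then have 2: "eval_mpoly (mterm (c i) (\<alpha> i) - mterm (d i) (\<beta> i)) q = 0"
      using Q by (blast intro: eval_vanishing_ideal)
    show ?thesis
      unfolding rescale_binomial[OF 1 2 nz[OF i] q]
      using mem by (simp add: W ideal_generated_def ring_module.span_scale)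
  qed
  \<comment> \<open>Rescaling respects sums and products, so the containment passes from the
    generators to the whole ideal.\<close>
  have "rescale (\<lambda>i. p i / q i) f \<in> vanishing_ideal W" if "f \<in> vanishing_ideal V" for f
    unfolding W
    by (rule ideal_generated_image[OF rescale_add rescale_mult _ that[unfolded V]])
      (use gens W in auto)
  then show ?thesis
    using p q by (intro initial_ideal_mono_rescale[of "\<lambda>i. p i / q i"]) simp_all
qed

text \<open>An equivalence class contains its representative (scale by 1). This supplies actual
  coordinate vectors, since \<open>no_zero_coordinates\<close> would hold vacuously for an empty
  set.\<close>

lemma proj_space_nonempty: "P \<in> proj_space \<Longrightarrow> P \<noteq> {}"
proof -
  assume "P \<in> proj_space"
  then obtain p where "P = proportional `` {p}"
    unfolding proj_space_def by (elim quotientE)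
  moreover have "(p, p) \<in> proportional"
    unfolding proportional_def by (auto intro: exI[of _ 1])
  ultimately show ?thesis by blast
qed

theorem proposition4p11:
  fixes V W :: "('v::finite \<Rightarrow> 'k::{alg_closed_field, field_char_0}) set set"
    and lt :: "'v exponent \<Rightarrow> 'v exponent \<Rightarrow> bool"
  assumes "binomial_variety V" and "binomial_variety W"
    and "same_binomial_exponents V W"
    and "\<exists>P\<in>V. no_zero_coordinates P"
    and "\<exists>Q\<in>W. no_zero_coordinates Q"
    and "monomial_order lt"
  shows "initial_ideal lt (vanishing_ideal V) = initial_ideal lt (vanishing_ideal W)"
proof -
  have "V \<subseteq> proj_space" and "W \<subseteq> proj_space"
    using assms(1,2) by (auto simp: binomial_variety_def proj_variety_def)
  moreover obtain P Q where PQ: "P \<in> V" "no_zero_coordinates P" "Q \<in> W" "no_zero_coordinates Q"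
    using assms(4,5) by blast
  ultimately obtain p q where pq: "p \<in> P" "q \<in> Q"
    using proj_space_nonempty by (metis ex_in_conv subsetD)
  obtain s :: nat and \<alpha> \<beta> :: "nat \<Rightarrow> 'v exponent" and a b c d :: "nat \<Rightarrow> 'k"
    where nz: "\<forall>i<s. a i \<noteq> 0 \<and> b i \<noteq> 0 \<and> c i \<noteq> 0 \<and> d i \<noteq> 0"
      and V: "vanishing_ideal V = ideal_generated {mterm (a i) (\<alpha> i) - mterm (b i) (\<beta> i) | i. i < s}"
      and W: "vanishing_ideal W = ideal_generated {mterm (c i) (\<alpha> i) - mterm (d i) (\<beta> i) | i. i < s}"
    using assms(3) unfolding same_binomial_exponents_def by (elim exE conjE) (rule that)
  show ?thesis
  proof (rule equalityI)
    show "initial_ideal lt (vanishing_ideal V) \<subseteq> initial_ideal lt (vanishing_ideal W)"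
      using nz by (intro initial_ideal_subset[OF _ V W PQ(1,2) pq(1) PQ(3,4) pq(2)]) simp
    \<comment> \<open>The exponents are shared, so the roles can be swapped; this uses the inverse
      rescaling by q/p.\<close>
    show "initial_ideal lt (vanishing_ideal W) \<subseteq> initial_ideal lt (vanishing_ideal V)"
      using nz by (intro initial_ideal_subset[OF _ W V PQ(3,4) pq(2) PQ(1,2) pq(1)]) simp
  qed
qed

end
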